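(* For every odd prime $p$, $$\frac{2^{p-1}-1}{p} \equiv \sum_{\substack{r \text{ odd}\\ 1\le r<p}}\frac{1}{r} \;-\; p\sum_{r=1}^{p-1}\frac{2^{r-1}}{r^2} \pmod{p^2}.$$
   Context: For a positive integer $m$ and rationals $\frac{a}{b},\frac{c}{d}$ with $\gcd(m,bd)=1$, the notation $\frac{a}{b}\equiv\frac{c}{d} \pmod m$ means $\frac{a}{b}-\frac{c}{d}=\frac{mP}{q}$ for some integers $P,q$ with $\gcd(m,q)=1$. *)

theory Defs
  imports Complex_Main "HOL-Computational_Algebra.Primes"
begin

(* The congruence of rationals is a partial notion, only meaningful for fractions whose
   denominators are coprime to the modulus; that side condition is made part of the relation.
   The conjuncts "_ \<noteq> 0" only matter for m = 1, as x / 0 = 0. *)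
definition rat_cong :: "rat \<Rightarrow> rat \<Rightarrow> nat \<Rightarrow> bool"
  (\<open>(\<open>indent=1 notation=\<open>mixfix rat_cong\<close>\<close>[_ \<equiv>\<^sub>\<rat> _] '(mod _'))\<close>)
  where "[x \<equiv>\<^sub>\<rat> y] (mod m) \<longleftrightarrow>
    (\<exists>a b c d :: int. b \<noteq> 0 \<and> d \<noteq> 0 \<and> x = of_int a / of_int b \<and> y = of_int c / of_int d \<and>
       coprime (int m) (b * d)) \<and>
    (\<exists>P q :: int. q \<noteq> 0 \<and> coprime (int m) q \<and> x - y = of_nat m * of_int P / of_int q)"

end

(* Integrating (1 - (1-t)^n) / t from 0 to x in two ways gives
     sum_{r=1}^n binom(n,r) (-1)^(r-1) x^r / r = sum_{r=1}^n (1 - (1-x)^r) / r.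
   At x = 2 and n = p odd the right-hand side is twice the sum of the 1/r over odd r <= p, while
   binom(p,r) = (p/r) binom(p-1,r-1).  Isolating the terms with r = p therefore gives an exact formula
   for the Fermat quotient, which differs from the claim only by the factors
   (-1)^(r-1) binom(p-1,r-1), all congruent to 1 modulo p. *)
theory Submission
  imports Defs
begin

text \<open>The localization of the integers obtained by inverting the nonzero integers coprime to
  \<open>m\<close>. It is a subring of the rationals, and congruence modulo \<open>m\<close> is
  congruence modulo its ideal generated by \<open>m\<close>. The closure lemmas below spare explicit
  numerators and denominators.\<close>

definition fractions_coprime_to :: "nat \<Rightarrow> rat set" where
  "fractions_coprime_to m =
    {x. \<exists>a b :: int. b \<noteq> 0 \<and> coprime (int m) b \<and> x = of_int a / of_int b}"

lemma fractions_coprime_toI: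
  "b \<noteq> 0 \<Longrightarrow> coprime (int m) b \<Longrightarrow> of_int a / of_int b \<in> fractions_coprime_to m"
  unfolding fractions_coprime_to_def by blast

lemma fractions_coprime_toE:
  assumes "x \<in> fractions_coprime_to m"
  obtains a b where "b \<noteq> 0" "coprime (int m) b" "x = of_int a / of_int b"
  using assms unfolding fractions_coprime_to_def by blast

lemma of_int_in_fractions_coprime_to [simp]: "of_int a \<in> fractions_coprime_to m"
  using fractions_coprime_toI[of 1 m a] by simp

lemma of_nat_in_fractions_coprime_to [simp]: "of_nat a \<in> fractions_coprime_to m"
  using of_int_in_fractions_coprime_to[of "int a"] by simp

lemma fractions_coprime_to_add:
  assumes "x \<in> fractions_coprime_to m" "y \<in> fractions_coprime_to m"
  shows "x + y \<in> fractions_coprime_to m"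
proof -
  obtain a b where x: "b \<noteq> 0" "coprime (int m) b" "x = of_int a / of_int b"
    using assms(1) by (rule fractions_coprime_toE)
  obtain c d where y: "d \<noteq> 0" "coprime (int m) d" "y = of_int c / of_int d"
    using assms(2) by (rule fractions_coprime_toE)
  have "x + y = of_int (a * d + c * b) / of_int (b * d)"
    using x y by (simp add: field_simps)
  then show ?thesis
    using x y fractions_coprime_toI[of "b * d" m "a * d + c * b"] by simp
qed

lemma fractions_coprime_to_mult:
  assumes "x \<in> fractions_coprime_to m" "y \<in> fractions_coprime_to m"
  shows "x * y \<in> fractions_coprime_to m"
proof -
  obtain a b where x: "b \<noteq> 0" "coprime (int m) b" "x = of_int a / of_int b"
    using assms(1) by (rule fractions_coprime_toE)
  obtain c d where y: "d \<noteq> 0" "coprime (int m) d" "y = of_int c / of_int d"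
    using assms(2) by (rule fractions_coprime_toE)
  show ?thesis
    using x y fractions_coprime_toI[of "b * d" m "a * c"] by simp
qed

lemma fractions_coprime_to_diff:
  assumes "x \<in> fractions_coprime_to m" "y \<in> fractions_coprime_to m"
  shows "x - y \<in> fractions_coprime_to m"
  using fractions_coprime_to_add[OF assms(1)
      fractions_coprime_to_mult[OF of_int_in_fractions_coprime_to[of "-1"] assms(2)]]
  by simp

lemma fractions_coprime_to_sum:
  "(\<And>i. i \<in> A \<Longrightarrow> f i \<in> fractions_coprime_to m) \<Longrightarrow> sum f A \<in> fractions_coprime_to m"
  \<comment> \<open>Membership of 0 covers the empty set and also infinite \<open>A\<close>, where
    the sum is 0 by convention.\<close>
  using of_int_in_fractions_coprime_to[of 0 m]
  by (induction A rule: infinite_finite_induct) (auto intro: fractions_coprime_to_add)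

text \<open>Membership of \<open>x\<close> follows from \<open>x = y + m z\<close> by closure. This
  matters for the Fermat quotient, whose given denominator \<open>p\<close> is not coprime to the
  modulus.\<close>

lemma rat_congI:
  assumes y: "y \<in> fractions_coprime_to m" and z: "z \<in> fractions_coprime_to m"
    and eq: "x - y = of_nat m * z"
  shows "[x \<equiv>\<^sub>\<rat> y] (mod m)"
proof -
  have "x = y + of_nat m * z"
    using eq by (simp add: algebra_simps)
  then have "x \<in> fractions_coprime_to m"
    using y z by (simp add: fractions_coprime_to_add fractions_coprime_to_mult)
  then obtain a b where "b \<noteq> 0" "coprime (int m) b" "x = of_int a / of_int b"
    by (rule fractions_coprime_toE)
  moreover obtain c d where "d \<noteq> 0" "coprime (int m) d" "y = of_int c / of_int d"
    using y by (rule fractions_coprime_toE)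
  moreover obtain P q where "q \<noteq> 0" "coprime (int m) q" "z = of_int P / of_int q"
    using z by (rule fractions_coprime_toE)
  ultimately show ?thesis
    unfolding rat_cong_def eq by (metis coprime_mult_right_iff times_divide_eq_right)
qed

lemma of_nat_binomial_absorb:
  "of_nat (Suc n choose Suc k) / of_nat (Suc n) =
    (of_nat (n choose k) / of_nat (Suc k) :: 'a::field_char_0)"
proof -
  have "of_nat (Suc k * (Suc n choose Suc k)) = (of_nat (Suc n * (n choose k)) :: 'a)"
    by (simp only: Suc_times_binomial)
  then have "of_nat (Suc k) * of_nat (Suc n choose Suc k) =
      (of_nat (Suc n) * of_nat (n choose k) :: 'a)"
    by (simp only: of_nat_mult)
  then show ?thesis
    by (simp del: of_nat_Suc binomial_Suc_Suc add: frac_eq_eq mult.commute)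
qed

text \<open>Induction on \<open>n\<close> replaces the integration, so the identity holds over any
  field of characteristic 0. The index is shifted to \<open>r = Suc k\<close>.\<close>

lemma sum_binomial_over_index:
  fixes x :: "'a::field_char_0"
  shows "(\<Sum>k<n. of_nat (n choose Suc k) * (- 1) ^ k * x ^ Suc k / of_nat (Suc k)) =
    (\<Sum>k<n. (1 - (1 - x) ^ Suc k) / of_nat (Suc k))"
proof (induction n)
  case 0
  show ?case by simp
next
  case (Suc n)
  let ?t = "\<lambda>k. (- 1) ^ k * x ^ Suc k :: 'a"
  \<comment> \<open>The binomial theorem with its constant term split off, then divided by
    \<open>Suc n\<close> using absorption, expresses the new summand on the right-hand side.\<close>
  have "(1 - x) ^ Suc n = (\<Sum>k\<le>Suc n. of_nat (Suc n choose k) * (- x) ^ k)"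
    using binomial_ring[of "- x" 1 "Suc n"] by simp
  also have "\<dots> = 1 - (\<Sum>k<Suc n. of_nat (Suc n choose Suc k) * ?t k)"
    unfolding sum.atMost_Suc_shift lessThan_Suc_atMost
    by (simp del: binomial_Suc_Suc add: sum_negf[symmetric] power_minus[of x] mult_ac)
  finally have "1 - (1 - x) ^ Suc n = (\<Sum>k<Suc n. of_nat (Suc n choose Suc k) * ?t k)"
    by (simp only: diff_diff_eq2 add_diff_cancel_left')
  then have new: "(1 - (1 - x) ^ Suc n) / of_nat (Suc n) =
      (\<Sum>k<Suc n. of_nat (n choose k) / of_nat (Suc k) * ?t k)"
    by (simp only: sum_divide_distrib times_divide_eq_left[symmetric] of_nat_binomial_absorb)
  \<comment> \<open>Pascal's rule splits the left-hand side into that new summand and the sum for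
    \<open>n\<close>.\<close>
  have "(\<Sum>k<Suc n. of_nat (Suc n choose Suc k) * (- 1) ^ k * x ^ Suc k / of_nat (Suc k)) =
      (\<Sum>k<Suc n. of_nat (n choose k) / of_nat (Suc k) * ?t k) +
      (\<Sum>k<Suc n. of_nat (n choose Suc k) * (- 1) ^ k * x ^ Suc k / of_nat (Suc k))"
    unfolding sum.distrib[symmetric]
    by (intro sum.cong refl) (simp del: of_nat_Suc power_Suc add: add_divide_distrib algebra_simps)
  \<comment> \<open>The extra term \<open>k = n\<close> vanishes because
    \<open>n choose Suc n\<close> is 0.\<close>
  also have "(\<Sum>k<Suc n. of_nat (n choose Suc k) * (- 1) ^ k * x ^ Suc k / of_nat (Suc k)) =
      (\<Sum>k<n. (1 - (1 - x) ^ Suc k) / of_nat (Suc k))"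
    using Suc.IH by simp
  finally show ?case
    using sum.lessThan_Suc[of "\<lambda>k. (1 - (1 - x) ^ Suc k) / of_nat (Suc k)" n]
    by (simp only: new[symmetric] add.commute)
qed

text \<open>Neighbouring entries of row \<open>p - 1\<close> of Pascal's triangle add up to an inner
  entry of row \<open>p\<close>, which \<open>p\<close> divides. So they are opposite modulo
  \<open>p\<close>, and the row starts with 1.\<close>

lemma prime_dvd_binomial_pred_minus_one:
  fixes p k :: nat
  assumes "prime p" "k < p"
  shows "int p dvd 1 - (- 1) ^ k * int ((p - 1) choose k)"
  using assms(2)
proof (induction k)
  case 0
  show ?case by simp
next
  case (Suc k)
  have "p choose Suc k = (p - 1 choose k) + (p - 1 choose Suc k)"
    using Suc.prems binomial_Suc_Suc[of "p - 1" k] by simp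
  moreover have "p dvd (p choose Suc k)"
    using Suc.prems assms(1) by (intro dvd_choose_prime) auto
  ultimately have "int p dvd int (p - 1 choose k) + int (p - 1 choose Suc k)"
    by (metis int_dvd_int_iff of_nat_add)
  then have "int p dvd (- 1) ^ k * (int (p - 1 choose k) + int (p - 1 choose Suc k))"
    by (rule dvd_mult)
  moreover have "int p dvd 1 - (- 1) ^ k * int (p - 1 choose k)"
    using Suc by simp
  ultimately have "int p dvd (1 - (- 1) ^ k * int (p - 1 choose k)) +
      (- 1) ^ k * (int (p - 1 choose k) + int (p - 1 choose Suc k))"
    by (rule dvd_add[rotated])
  then show ?case
    by (simp add: algebra_simps)
qed

text \<open>An exact identity for every odd \<open>p\<close>; primality enters only when the signed
  binomials are replaced by 1 modulo \<open>p\<close>.\<close>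

lemma fermat_quotient_two_eq:
  fixes p :: nat
  assumes "odd p"
  shows "(2 ^ (p - 1) - 1) / of_nat p =
    ((\<Sum>r | odd r \<and> 1 \<le> r \<and> r < p. 1 / of_nat r) -
    of_nat p * (\<Sum>r = 1..p - 1. 2 ^ (r - 1) / (of_nat r)\<^sup>2 *
      ((- 1) ^ (r - 1) * of_nat ((p - 1) choose (r - 1)))) :: 'a::field_char_0)"
    (is "?q = ?S - of_nat p * ?T")
proof -
  obtain n where n: "p = Suc n" "even n"
    using assms by (cases p) auto
  have shift: "{1..n} = Suc ` {..<n}"
    by (simp add: image_Suc_lessThan)
  let ?f = "\<lambda>k. of_nat (p choose Suc k) * (- 1) ^ k * 2 ^ Suc k / of_nat (Suc k) :: 'a"
  let ?g = "\<lambda>k. (1 - (1 - 2) ^ Suc k) / of_nat (Suc k) :: 'a"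
  \<comment> \<open>Absorption extracts the factor \<open>p\<close> and supplies the second
    \<open>Suc k\<close> of the squared denominator.\<close>
  have "?f k = 2 * (of_nat p * (2 ^ k / (of_nat (Suc k))\<^sup>2 * ((- 1) ^ k * of_nat (n choose k))))" for k
  proof -
    have "of_nat (p choose Suc k) = of_nat p * (of_nat (n choose k) / of_nat (Suc k) :: 'a)"
      unfolding n of_nat_binomial_absorb[symmetric]
      by (simp del: of_nat_Suc binomial_Suc_Suc)
    then show ?thesis
      by (simp del: of_nat_Suc binomial_Suc_Suc add: power2_eq_square)
  qed
  then have "(\<Sum>k<n. ?f k) = 2 * (of_nat p * ?T)"
    unfolding n(1) diff_Suc_1 shift by (simp del: of_nat_Suc add: sum.reindex sum_distrib_left)
  moreover have "(\<Sum>k<n. ?g k) = 2 * ?S"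
  proof -
    have "(\<Sum>k<n. ?g k) = (\<Sum>r\<in>{1..n}. (1 - (- 1) ^ r) / of_nat r)"
      unfolding shift by (simp add: sum.reindex)
    \<comment> \<open>The numerator is 0 for even \<open>r\<close> and 2 for odd
      \<open>r\<close>.\<close>
    also have "\<dots> = (\<Sum>r | odd r \<and> 1 \<le> r \<and> r < p. 2 * (1 / of_nat r))"
      using n by (intro sum.mono_neutral_cong_right) auto
    finally show ?thesis
      by (simp only: sum_distrib_left)
  qed
  \<comment> \<open>The terms with \<open>r = p\<close>; their signs are determined by
    \<open>n\<close> being even.\<close>
  moreover have "?f n = 2 * 2 ^ n / of_nat p" "?g n = 2 / of_nat p"
    using n by simp_all
  moreover have "(\<Sum>k<n. ?f k) + ?f n = (\<Sum>k<n. ?g k) + ?g n"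
    using sum_binomial_over_index[of p "2 :: 'a"] unfolding n(1) by (simp only: sum.lessThan_Suc)
  ultimately have "2 * (of_nat p * ?T) + 2 * 2 ^ n / of_nat p = 2 * ?S + 2 / of_nat p"
    by simp
  then have "2 * (of_nat p * ?T + 2 ^ n / of_nat p) = 2 * (?S + 1 / of_nat p)"
    by (simp only: distrib_left times_divide_eq_right mult_1_right)
  then have "of_nat p * ?T + 2 ^ n / of_nat p = ?S + 1 / of_nat p"
    by (simp only: mult_cancel_left numeral_neq_zero simp_thms)
  then show "?q = ?S - of_nat p * ?T"
    unfolding n(1) diff_Suc_1 by (simp only: diff_divide_distrib algebra_simps)
qed

theorem theorem1:
  fixes p :: nat
  assumes "prime p" and "odd p"
  shows "[(2 ^ (p - 1) - 1) / of_nat p \<equiv>\<^sub>\<rat>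
          (\<Sum>r | odd r \<and> 1 \<le> r \<and> r < p. 1 / of_nat r)
            - of_nat p * (\<Sum>r = 1..p - 1. 2 ^ (r - 1) / (of_nat r)\<^sup>2)] (mod p\<^sup>2)"
proof -
  let ?S = "\<Sum>r | odd r \<and> 1 \<le> r \<and> r < p. 1 / of_nat r :: rat"
  let ?w = "\<lambda>r. 2 ^ (r - 1) / (of_nat r)\<^sup>2 :: rat"
  let ?c = "\<lambda>r. (- 1) ^ (r - 1) * int ((p - 1) choose (r - 1))"
  let ?F = "fractions_coprime_to (p\<^sup>2)"
  have coprime: "coprime (int (p\<^sup>2)) (int r)" if "1 \<le> r" "r < p" for r
    using that assms(1) prime_imp_coprime[of p r] nat_dvd_not_less[of r p] by simp
  have inv: "1 / of_nat r \<in> ?F" if "1 \<le> r" "r < p" for r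
    using coprime[OF that] that fractions_coprime_toI[of "int r" "p\<^sup>2" 1] by simp
  have w: "?w r \<in> ?F" if "r \<in> {1..p - 1}" for r
    using coprime[of r] that fractions_coprime_toI[of "(int r)\<^sup>2" "p\<^sup>2" "2 ^ (r - 1)"] by auto
  have "\<forall>r\<in>{1..p - 1}. \<exists>e. 1 - ?c r = int p * e"
  proof
    fix r assume "r \<in> {1..p - 1}"
    then have "int p dvd 1 - ?c r"
      using assms(1) by (intro prime_dvd_binomial_pred_minus_one) auto
    then show "\<exists>e. 1 - ?c r = int p * e"
      by (auto elim: dvdE)
  qed
  then obtain e where e: "\<And>r. r \<in> {1..p - 1} \<Longrightarrow> 1 - ?c r = int p * e r"
    by metis
  show ?thesis
  proof (rule rat_congI)
    show "?S - of_nat p * (\<Sum>r = 1..p - 1. ?w r) \<in> ?F"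
      using inv w by (intro fractions_coprime_to_diff fractions_coprime_to_mult
          fractions_coprime_to_sum) auto
    \<comment> \<open>This is the cofactor of the modulus: one factor \<open>p\<close> stands before
      the sum in the exact formula, the other comes from \<open>1 - ?c r = p * e r\<close>.\<close>
    show "(\<Sum>r = 1..p - 1. ?w r * of_int (e r)) \<in> ?F"
      using w by (intro fractions_coprime_to_mult fractions_coprime_to_sum) auto
    have "?w r - ?w r * of_int (?c r) = of_nat p * (?w r * of_int (e r))"
      if "r \<in> {1..p - 1}" for r
    proof -
      have "?w r - ?w r * of_int (?c r) = ?w r * of_int (1 - ?c r)"
        by (simp only: of_int_diff of_int_1 right_diff_distrib mult_1_right)
      then show ?thesis
        unfolding e[OF that] by simp
    qed
    then have "(\<Sum>r = 1..p - 1. ?w r - ?w r * of_int (?c r)) =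
        (\<Sum>r = 1..p - 1. of_nat p * (?w r * of_int (e r)))"
      by (rule sum.cong[OF refl])
    then have "(\<Sum>r = 1..p - 1. ?w r) - (\<Sum>r = 1..p - 1. ?w r * of_int (?c r)) =
        of_nat p * (\<Sum>r = 1..p - 1. ?w r * of_int (e r))"
      by (simp only: sum_subtractf sum_distrib_left)
    moreover have "(2 ^ (p - 1) - 1) / of_nat p =
        ?S - of_nat p * (\<Sum>r = 1..p - 1. ?w r * of_int (?c r))"
      using fermat_quotient_two_eq[OF assms(2), where 'a = rat] by simp
    ultimately show "(2 ^ (p - 1) - 1) / of_nat p - (?S - of_nat p * (\<Sum>r = 1..p - 1. ?w r)) =
        of_nat (p\<^sup>2) * (\<Sum>r = 1..p - 1. ?w r * of_int (e r))"
      by (simp add: right_diff_distrib[symmetric] power2_eq_square)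
  qed
qed

end
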